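(* Let $G_1$ and $G_2$ be finite simple undirected graphs on $n$ vertices, with $m_1$ and $m_2$ edges respectively, where $n\equiv 0\pmod 4$ and $m_2=m_1+\frac n4$. Let $p,k$ be integers with $k\ge 4$, $p\ge 4n+k$ and $m_2\le\frac{n(k-2)}{4}+\frac{k^2}{16}$. Then $$LE\big(D[G_1^*]\vee\overline{K_p}\big)=LE\big((D[G_2])^*\vee\overline{K_p}\big).$$
   Context: The Laplacian energy of a graph $H$ with $N$ vertices, $M$ edges and Laplacian eigenvalues $\nu_1,\dots,\nu_N$ (eigenvalues of $D-A$, with $A$ the adjacency matrix and $D$ the diagonal degree matrix) is $LE(H)=\sum_{i=1}^N|\nu_i-\frac{2M}{N}|$. The double graph $D[G]$ is obtained by taking two copies of $G$ and joining each vertex in one copy with the neighbours of the corresponding vertex in the other copy; i.e. it has vertex set $V(G)\times\{1,2\}$ with $(u,a)$ adjacent to $(v,b)$ iff $u$ is adjacent to $v$ in $G$. For $G$ with vertex set $\{v_1,\dots,v_n\}$, the extended double cover $G^*$ is the bipartite graph with parts $X=\{x_1,\dots,x_n\}$, $Y=\{y_1,\dots,y_n\}$, where $x_i$ is adjacent to $y_j$ iff $i=j$ or $v_i$ is adjacent to $v_j$ in $G$. The join $H_1\vee H_2$ is the disjoint union of $H_1$ and $H_2$ together with all edges between $V(H_1)$ and $V(H_2)$. $\overline{K_p}$ is the edgeless graph on $p$ vertices. *)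

theory Defs
  imports "Graph_Theory.Pair_Digraph" "Jordan_Normal_Form.Char_Poly"
begin

text \<open>
  Finite simple undirected graphs are represented by the locale \<^locale>\<open>pair_graph\<close>: finite
  vertex set, irreflexive symmetric arc relation.  An undirected edge is thus a pair of opposite
  arcs, so edges are counted through their unordered endpoint sets, and the degree of a vertex is
  its out-degree.
\<close>

definition num_edges :: "'a pair_pre_digraph \<Rightarrow> nat" where
  "num_edges G = card ((\<lambda>(u, v). {u, v}) ` parcs G)"

definition adjacency_mat :: "'a list \<Rightarrow> 'a pair_pre_digraph \<Rightarrow> real mat" where
  "adjacency_mat vs G = mat (length vs) (length vs)
     (\<lambda>(i, j). if (vs ! i, vs ! j) \<in> parcs G then 1 else 0)"

definition degree_mat :: "'a list \<Rightarrow> 'a pair_pre_digraph \<Rightarrow> real mat" where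
  "degree_mat vs G = mat (length vs) (length vs)
     (\<lambda>(i, j). if i = j then real (out_degree (with_proj G) (vs ! i)) else 0)"

definition laplacian_mat :: "'a list \<Rightarrow> 'a pair_pre_digraph \<Rightarrow> real mat" where
  "laplacian_mat vs G = degree_mat vs G - adjacency_mat vs G"

text \<open>
  The eigenvalues with multiplicity: roots of the characteristic polynomial.  The enumeration of
  the vertices chosen here is irrelevant (\<open>laplacian_spectrum_eq\<close>), and all \<open>N\<close> eigenvalues are
  real (\<open>size_laplacian_spectrum\<close>).
\<close>

definition laplacian_spectrum :: "'a pair_pre_digraph \<Rightarrow> real multiset" where
  "laplacian_spectrum G =
     proots (char_poly (laplacian_mat (SOME vs. distinct vs \<and> set vs = pverts G) G))"

definition laplacian_energy :: "'a pair_pre_digraph \<Rightarrow> real" where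
  "laplacian_energy G =
     (\<Sum>\<nu> \<in># laplacian_spectrum G. \<bar>\<nu> - 2 * real (num_edges G) / real (card (pverts G))\<bar>)"

definition double_graph :: "'a pair_pre_digraph \<Rightarrow> ('a \<times> nat) pair_pre_digraph" where
  "double_graph G = \<lparr> pverts = pverts G \<times> {1, 2},
     parcs = {((u, a), (v, b)) | u v a b. (u, v) \<in> parcs G \<and> a \<in> {1, 2} \<and> b \<in> {1, 2}} \<rparr>"

text \<open>\<open>Inl v\<close> and \<open>Inr v\<close> are the copies of \<open>v\<close> in the parts \<open>X\<close> and \<open>Y\<close>.\<close>

definition extended_double_cover :: "'a pair_pre_digraph \<Rightarrow> ('a + 'a) pair_pre_digraph" where
  "extended_double_cover G = \<lparr> pverts = pverts G <+> pverts G,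
     parcs = {(Inl u, Inr v) | u v. u \<in> pverts G \<and> v \<in> pverts G \<and> (u = v \<or> (u, v) \<in> parcs G)}
           \<union> {(Inr v, Inl u) | u v. u \<in> pverts G \<and> v \<in> pverts G \<and> (u = v \<or> (u, v) \<in> parcs G)} \<rparr>"

definition graph_join ::
  "'a pair_pre_digraph \<Rightarrow> 'b pair_pre_digraph \<Rightarrow> ('a + 'b) pair_pre_digraph" where
  "graph_join G H = \<lparr> pverts = pverts G <+> pverts H,
     parcs = {(Inl u, Inl v) | u v. (u, v) \<in> parcs G} \<union> {(Inr u, Inr v) | u v. (u, v) \<in> parcs H}
           \<union> {(Inl u, Inr v) | u v. u \<in> pverts G \<and> v \<in> pverts H}
           \<union> {(Inr v, Inl u) | u v. u \<in> pverts G \<and> v \<in> pverts H} \<rparr>"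

definition edgeless_graph :: "nat \<Rightarrow> nat pair_pre_digraph" where
  "edgeless_graph p = \<lparr> pverts = {..<p}, parcs = {} \<rparr>"


subsection \<open>The constructions yield finite simple graphs\<close>

lemma pair_graphI:
  assumes "finite (pverts G)" "parcs G \<subseteq> pverts G \<times> pverts G" "sym (parcs G)" "irrefl (parcs G)"
  shows "pair_graph G"
  using assms finite_subset[OF assms(2)]
  by unfold_locales (auto simp: symmetric_def irrefl_def)

lemma pair_graph_arcs:
  assumes "pair_graph G"
  shows "finite (pverts G)" "(u, v) \<in> parcs G \<Longrightarrow> u \<in> pverts G" "(u, v) \<in> parcs G \<Longrightarrow> v \<in> pverts G"
    "(u, v) \<in> parcs G \<Longrightarrow> (v, u) \<in> parcs G" "(u, u) \<notin> parcs G"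
proof -
  interpret pair_graph G by fact
  show "finite (pverts G)" "(u, v) \<in> parcs G \<Longrightarrow> u \<in> pverts G" "(u, v) \<in> parcs G \<Longrightarrow> v \<in> pverts G"
    "(u, v) \<in> parcs G \<Longrightarrow> (v, u) \<in> parcs G" "(u, u) \<notin> parcs G"
    using pair_finite_verts in_arcsD1 in_arcsD2 arcs_symmetric no_loops'[of u u] by auto
qed

lemma pair_graph_sym: "pair_graph G \<Longrightarrow> (u, v) \<in> parcs G \<longleftrightarrow> (v, u) \<in> parcs G"
  using pair_graph_arcs(4) by metis

lemma pair_graph_double_graph:
  assumes "pair_graph G"
  shows "pair_graph (double_graph G)"
  using pair_graph_arcs(1,5)[OF assms] pair_graph_sym[OF assms]
  by (intro pair_graphI)
    (auto simp: double_graph_def sym_def irrefl_def dest: pair_graph_arcs(2,3)[OF assms])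

lemma pair_graph_extended_double_cover:
  assumes "pair_graph G"
  shows "pair_graph (extended_double_cover G)"
  using pair_graph_arcs(1)[OF assms]
  by (intro pair_graphI) (auto simp: extended_double_cover_def sym_def irrefl_def)

lemma pair_graph_graph_join:
  assumes "pair_graph G" "pair_graph H"
  shows "pair_graph (graph_join G H)"
  using pair_graph_arcs(1,5)[OF assms(1)] pair_graph_arcs(1,5)[OF assms(2)]
    pair_graph_sym[OF assms(1)] pair_graph_sym[OF assms(2)]
  by (intro pair_graphI)
    (auto simp: graph_join_def sym_def irrefl_def
      dest: pair_graph_arcs(2,3)[OF assms(1)] pair_graph_arcs(2,3)[OF assms(2)])

lemma pair_graph_edgeless_graph: "pair_graph (edgeless_graph p)"
  by (rule pair_graphI) (auto simp: edgeless_graph_def sym_def irrefl_def)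


subsection \<open>The spectrum does not depend on the vertex enumeration\<close>

lemma laplacian_mat_carrier [simp]: "laplacian_mat vs G \<in> carrier_mat (length vs) (length vs)"
  by (auto simp: laplacian_mat_def degree_mat_def adjacency_mat_def intro!: minus_carrier_mat)

definition laplacian_entry :: "'a pair_pre_digraph \<Rightarrow> 'a \<Rightarrow> 'a \<Rightarrow> real" where
  "laplacian_entry G u v =
     (if u = v then real (out_degree (with_proj G) u) else 0) - (if (u, v) \<in> parcs G then 1 else 0)"

lemma laplacian_mat_eq:
  assumes "distinct vs"
  shows "laplacian_mat vs G = mat (length vs) (length vs) (\<lambda>(i, j). laplacian_entry G (vs ! i) (vs ! j))"
  using assms
  by (intro eq_matI)
    (auto simp: laplacian_mat_def degree_mat_def adjacency_mat_def laplacian_entry_def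
      nth_eq_iff_index_eq)

lemma sum_nth_if_eq:
  fixes g :: "'a \<Rightarrow> real"
  assumes "distinct ys" "x \<in> set ys"
  shows "(\<Sum>j = 0..<length ys. (if x = ys ! j then 1 else 0) * g (ys ! j)) = g x"
proof -
  have "(\<Sum>j = 0..<length ys. (if x = ys ! j then 1 else 0) * g (ys ! j)) =
        (\<Sum>y\<in>set ys. (if x = y then 1 else 0) * g y)"
    by (rule sum.reindex_bij_betw)
      (use assms in \<open>auto simp: bij_betw_def inj_on_def nth_eq_iff_index_eq set_conv_nth\<close>)
  also have "\<dots> = (\<Sum>y\<in>set ys. if x = y then g y else 0)"
    by (rule sum.cong) auto
  also have "\<dots> = g x"
    using assms by simp
  finally show ?thesis .
qed

lemma similar_mat_reenumerate:
  fixes F :: "'a \<Rightarrow> 'a \<Rightarrow> real"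
  assumes "distinct xs" "distinct ys" "set xs = set ys"
  shows "similar_mat (mat (length xs) (length xs) (\<lambda>(i, j). F (xs ! i) (xs ! j)))
                     (mat (length ys) (length ys) (\<lambda>(i, j). F (ys ! i) (ys ! j)))"
proof -
  have len: "length ys = length xs"
    using assms by (metis distinct_card)
  define n where "n = length xs"
  define P where "P = mat n n (\<lambda>(i, j). if xs ! i = ys ! j then 1 else 0 :: real)"
  define Q where "Q = mat n n (\<lambda>(i, j). if ys ! i = xs ! j then 1 else 0 :: real)"
  define A where "A = mat n n (\<lambda>(i, j). F (xs ! i) (xs ! j))"
  define B where "B = mat n n (\<lambda>(i, j). F (ys ! i) (ys ! j))"
  have mem: "xs ! i \<in> set ys" "ys ! i \<in> set xs" if "i < n" for i
    using that assms len n_def nth_mem by metis+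
  have sx: "(\<Sum>j = 0..<n. (if x = xs ! j then 1 else 0) * g (xs ! j)) = g x"
    if "x \<in> set xs" for x and g :: "'a \<Rightarrow> real"
    using sum_nth_if_eq[OF assms(1) that] n_def by simp
  have sy: "(\<Sum>j = 0..<n. (if x = ys ! j then 1 else 0) * g (ys ! j)) = g x"
    if "x \<in> set ys" for x and g :: "'a \<Rightarrow> real"
    using sum_nth_if_eq[OF assms(2) that] n_def len by simp
  have dims: "P \<in> carrier_mat n n" "Q \<in> carrier_mat n n" "A \<in> carrier_mat n n" "B \<in> carrier_mat n n"
    by (auto simp: P_def Q_def A_def B_def)
  have PQ: "P * Q = 1\<^sub>m n"
  proof (rule eq_matI)
    fix i j assume "i < dim_row (1\<^sub>m n :: real mat)" "j < dim_col (1\<^sub>m n :: real mat)"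
    hence ij: "i < n" "j < n" by auto
    have "(P * Q) $$ (i, j) =
        (\<Sum>k = 0..<n. (if xs ! i = ys ! k then 1 else 0) * (if ys ! k = xs ! j then 1 else 0))"
      using ij by (simp add: P_def Q_def scalar_prod_def)
    also have "\<dots> = (if xs ! i = xs ! j then 1 else 0)"
      using sy[OF mem(1)[OF ij(1)], of "\<lambda>y. if y = xs ! j then 1 else 0"] by simp
    also have "\<dots> = 1\<^sub>m n $$ (i, j)"
      using ij assms(1) by (simp add: n_def nth_eq_iff_index_eq)
    finally show "(P * Q) $$ (i, j) = 1\<^sub>m n $$ (i, j)" .
  qed (auto simp: P_def Q_def)
  have QP: "Q * P = 1\<^sub>m n"
    using mat_mult_left_right_inverse[OF dims(1,2) PQ] .
  have AP: "P * B * Q = A"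
  proof (rule eq_matI)
    fix i j assume "i < dim_row A" "j < dim_col A"
    hence ij: "i < n" "j < n" by (auto simp: A_def)
    have PB: "(P * B) $$ (i, k) = F (xs ! i) (ys ! k)" if "k < n" for k
    proof -
      have "(P * B) $$ (i, k) = (\<Sum>l = 0..<n. (if xs ! i = ys ! l then 1 else 0) * F (ys ! l) (ys ! k))"
        using ij that by (simp add: P_def B_def scalar_prod_def)
      also have "\<dots> = F (xs ! i) (ys ! k)"
        by (rule sy[OF mem(1)[OF ij(1)], of "\<lambda>y. F y (ys ! k)"])
      finally show ?thesis .
    qed
    have "(C * Q) $$ (i, j) = (\<Sum>k = 0..<n. C $$ (i, k) * Q $$ (k, j))"
      if "C \<in> carrier_mat n n" for C
      using ij that dims(2) by (simp add: scalar_prod_def)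
    hence "(P * B * Q) $$ (i, j) = (\<Sum>k = 0..<n. (P * B) $$ (i, k) * Q $$ (k, j))"
      using mult_carrier_mat[OF dims(1,4)] by blast
    also have "\<dots> = (\<Sum>k = 0..<n. (if xs ! j = ys ! k then 1 else 0) * F (xs ! i) (ys ! k))"
      by (rule sum.cong) (use ij in \<open>auto simp: PB Q_def\<close>)
    also have "\<dots> = F (xs ! i) (xs ! j)"
      by (rule sy[OF mem(1)[OF ij(2)], of "\<lambda>y. F (xs ! i) y"])
    finally show "(P * B * Q) $$ (i, j) = A $$ (i, j)"
      using ij by (simp add: A_def)
  qed (use dims in auto)
  have "similar_mat A B"
    by (rule similar_matI[of _ _ P Q n]) (use dims PQ QP AP in auto)
  thus ?thesis
    using len by (simp add: A_def B_def n_def)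
qed

lemma laplacian_spectrum_eq:
  assumes "distinct vs" "set vs = pverts G"
  shows "laplacian_spectrum G = proots (char_poly (laplacian_mat vs G))"
proof -
  define ws where "ws = (SOME vs. distinct vs \<and> set vs = pverts G)"
  have "distinct ws \<and> set ws = pverts G"
    unfolding ws_def by (rule someI[of _ vs]) (use assms in auto)
  hence "similar_mat (laplacian_mat ws G) (laplacian_mat vs G)"
    using assms by (simp add: laplacian_mat_eq similar_mat_reenumerate)
  thus ?thesis
    by (simp add: laplacian_spectrum_def char_poly_similar flip: ws_def)
qed


subsection \<open>All Laplacian eigenvalues are real\<close>

lemma complex_eigenvalue_of_real_symmetric:
  fixes A :: "real mat"
  assumes A: "A \<in> carrier_mat n n" and sym: "\<And>i j. i < n \<Longrightarrow> j < n \<Longrightarrow> A $$ (i, j) = A $$ (j, i)"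
    and ev: "eigenvalue (map_mat complex_of_real A) z"
  shows "z \<in> \<real>"
proof -
  from ev obtain v where "eigenvector (map_mat complex_of_real A) v z"
    by (auto simp: eigenvalue_def)
  hence v: "v \<in> carrier_vec n" "v \<noteq> 0\<^sub>v n" "map_mat complex_of_real A *\<^sub>v v = z \<cdot>\<^sub>v v"
    using A by (auto simp: eigenvector_def)
  define a where "a i j = complex_of_real (A $$ (i, j))" for i j
  have row: "(\<Sum>j = 0..<n. a i j * v $ j) = z * v $ i" if "i < n" for i
  proof -
    have "(map_mat complex_of_real A *\<^sub>v v) $ i = (\<Sum>j = 0..<n. a i j * v $ j)"
      using that A v(1) by (simp add: scalar_prod_def a_def)
    thus ?thesis using v that by simp
  qed
  define s where "s = (\<Sum>i = 0..<n. cnj (v $ i) * v $ i)"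
  have zs: "(\<Sum>i = 0..<n. \<Sum>j = 0..<n. cnj (v $ i) * a i j * v $ j) = z * s"
  proof -
    have "(\<Sum>i = 0..<n. \<Sum>j = 0..<n. cnj (v $ i) * a i j * v $ j) =
          (\<Sum>i = 0..<n. cnj (v $ i) * (\<Sum>j = 0..<n. a i j * v $ j))"
      by (simp add: sum_distrib_left mult.assoc)
    also have "\<dots> = (\<Sum>i = 0..<n. cnj (v $ i) * (z * v $ i))"
      by (rule sum.cong) (auto simp: row)
    also have "\<dots> = z * s"
      by (simp add: s_def sum_distrib_left mult_ac)
    finally show ?thesis .
  qed
  have "cnj (z * s) = (\<Sum>i = 0..<n. \<Sum>j = 0..<n. v $ i * a i j * cnj (v $ j))"
    by (simp add: a_def flip: zs)
  also have "\<dots> = (\<Sum>j = 0..<n. \<Sum>i = 0..<n. v $ i * a i j * cnj (v $ j))"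
    by (rule sum.swap)
  also have "\<dots> = (\<Sum>j = 0..<n. \<Sum>i = 0..<n. cnj (v $ j) * a j i * v $ i)"
    by (intro sum.cong refl) (auto simp: a_def sym)
  also have "\<dots> = z * s" by (rule zs)
  finally have *: "cnj (z * s) = z * s" .
  have "s = complex_of_real (\<Sum>i = 0..<n. (cmod (v $ i))\<^sup>2)"
    unfolding s_def of_real_sum by (intro sum.cong refl) (metis complex_norm_square mult.commute)
  moreover have "(\<Sum>i = 0..<n. (cmod (v $ i))\<^sup>2) \<noteq> 0"
  proof
    assume "(\<Sum>i = 0..<n. (cmod (v $ i))\<^sup>2) = 0"
    hence "\<forall>i<n. v $ i = 0"
      by (subst (asm) sum_nonneg_eq_0_iff) auto
    hence "v = 0\<^sub>v n" using v(1) by auto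
    with v(2) show False by contradiction
  qed
  ultimately have "cnj s = s" "s \<noteq> 0"
    by (simp_all del: of_real_sum)
  with * have "cnj z = z" by simp
  thus ?thesis by (simp add: Reals_cnj_iff)
qed

lemma size_proots_char_poly_real_symmetric:
  fixes A :: "real mat"
  assumes A: "A \<in> carrier_mat n n" and sym: "\<And>i j. i < n \<Longrightarrow> j < n \<Longrightarrow> A $$ (i, j) = A $$ (j, i)"
  shows "size (proots (char_poly A)) = n"
proof -
  let ?C = "map_mat complex_of_real A"
  have C: "?C \<in> carrier_mat n n" using A by simp
  have cp: "char_poly ?C = map_poly complex_of_real (char_poly A)"
    by (rule of_real_hom.char_poly_hom[OF A])
  obtain as where as: "char_poly ?C = (\<Prod>a\<leftarrow>as. [:- a, 1:])" "length as = n"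
    using char_poly_factorized[OF C] by blast
  have re: "complex_of_real (Re a) = a" if "a \<in> set as" for a
  proof -
    have "poly (char_poly ?C) a = 0"
      using that by (auto simp: as(1) poly_prod_list prod_list_zero_iff)
    hence "eigenvalue ?C a" using eigenvalue_root_char_poly[OF C] by simp
    hence "a \<in> \<real>" using complex_eigenvalue_of_real_symmetric[OF A sym] by blast
    thus ?thesis by (rule of_real_Re)
  qed
  interpret map_poly_inj_idom_hom complex_of_real ..
  have "map_poly complex_of_real (\<Prod>a\<leftarrow>as. [:- Re a, 1:]) = (\<Prod>a\<leftarrow>as. [:- a, 1:])"
    using re by (induction as) (auto simp: hom_distribs)
  hence "map_poly complex_of_real (\<Prod>a\<leftarrow>as. [:- Re a, 1:]) = map_poly complex_of_real (char_poly A)"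
    using as(1) cp by simp
  hence "char_poly A = (\<Prod>a\<leftarrow>as. [:- Re a, 1:])"
    by simp
  moreover have "size (proots (\<Prod>a\<leftarrow>bs. [:- Re a, 1:])) = length bs" for bs
  proof (induction bs)
    case (Cons b bs)
    have "(\<Prod>a\<leftarrow>bs. [:- Re a, 1:]) \<noteq> 0"
      by (auto simp: prod_list_zero_iff)
    hence "proots ([:- Re b, 1:] * (\<Prod>a\<leftarrow>bs. [:- Re a, 1:])) =
           proots [:- Re b, 1:] + proots (\<Prod>a\<leftarrow>bs. [:- Re a, 1:])"
      by (intro proots_mult) auto
    thus ?case using Cons.IH by (simp del: mult_pCons_left)
  qed simp
  ultimately show ?thesis using as(2) by simp
qed

lemma size_laplacian_spectrum:
  assumes "pair_graph G"
  shows "size (laplacian_spectrum G) = card (pverts G)"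
proof -
  obtain vs where vs: "distinct vs" "set vs = pverts G"
    using finite_distinct_list pair_graph_arcs(1)[OF assms] by blast
  have "size (proots (char_poly (laplacian_mat vs G))) = length vs"
    by (rule size_proots_char_poly_real_symmetric)
      (auto simp: laplacian_mat_eq vs(1) laplacian_entry_def pair_graph_arcs(4)[OF assms])
  thus ?thesis
    using vs distinct_card[OF vs(1)] by (simp add: laplacian_spectrum_eq)
qed

end

theory Submission
  imports Defs "Jordan_Normal_Form.Schur_Decomposition"
begin

text \<open>
  Joining \<open>p\<close> independent vertices to a graph \<open>H\<close> with \<open>N\<close> vertices shifts the Laplacian eigenvalues
  of \<open>H\<close>, except for one eigenvalue \<open>0\<close>, by \<open>p\<close>; the remaining eigenvalues of the join are \<open>0\<close>,
  \<open>N + p\<close> and \<open>p - 1\<close> copies of \<open>N\<close> (\<open>laplacian_spectrum_graph_join\<close>).  Laplacian eigenvalues are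
  nonnegative, so if \<open>p\<close> is at least the average degree \<open>a\<close> of the join, then all shifted eigenvalues
  \<open>\<mu> + p\<close> lie on the same side of \<open>a\<close>.  The absolute values in their contribution to the energy can
  be dropped, and only their sum matters, which is known from the trace: twice the number of
  edges, plus the shifts.  Hence the energy of the join depends only on \<open>p\<close> and on the numbers of
  vertices and edges of \<open>H\<close> (\<open>laplacian_energy_join_edgeless\<close>).

  The two graphs of the theorem both have \<open>4n\<close> vertices, and the relation between \<open>m\<^sub>1\<close> and \<open>m\<^sub>2\<close>
  says precisely that both have \<open>2n + 8m\<^sub>2 = 4n + 8m\<^sub>1\<close> edges.  The bounds on \<open>p\<close> and \<open>m\<^sub>2\<close> guarantee
  that \<open>p\<close> is at least the average degree.

  The spectrum of the join comes from adding the all-ones matrix to its Laplacian: this cancels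
  the entries \<open>-1\<close> between the two parts, so that the result is block diagonal, with blocks that are
  themselves of the form Laplacian plus scalar plus all-ones.  All these matrices have constant
  row sums, and for such matrices the effect of adding an all-ones matrix on the characteristic
  polynomial is explicit (\<open>char_poly_add_all_const\<close>).
\<close>

section \<open>Characteristic polynomials\<close>

text \<open>
  The all-ones vector is an eigenvector for the row sum \<open>c\<close>.  A change of basis that makes it the
  first basis vector yields a block triangular matrix whose upper left entry is \<open>c\<close>.  Adding the
  constant \<open>t\<close> to all entries keeps the row sums constant and leaves the lower right block of the
  transformed matrix unchanged, because that block consists of differences of rows.
\<close>

lemma char_poly_add_all_const:
  fixes A :: "'a :: field mat"
  assumes A: "A \<in> carrier_mat n n"
    and row_sum: "\<And>i. i < n \<Longrightarrow> (\<Sum>j = 0..<n. A $$ (i, j)) = c"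
  shows "char_poly (A + mat n n (\<lambda>_. t)) * [:- c, 1:] = char_poly A * [:- (c + of_nat n * t), 1:]"
proof (cases n)
  case 0
  hence "A + mat n n (\<lambda>_. t) = A" using A by (intro eq_matI) auto
  thus ?thesis using 0 by simp
next
  case n: (Suc m)
  \<comment> \<open>\<open>P\<close> is the identity with the first column replaced by ones, and \<open>Q\<close> is its inverse; \<open>R\<close> is the
    lower right block after the change of basis.\<close>
  define P where "P = mat n n (\<lambda>(i, j). if i = j \<or> j = 0 then 1 else 0 :: 'a)"
  define Q where "Q = mat n n (\<lambda>(i, j). if i = j then 1 else if j = 0 then - 1 else 0 :: 'a)"
  define R where "R = mat m m (\<lambda>(i, j). A $$ (Suc i, Suc j) - A $$ (0, Suc j))"
  have dims: "P \<in> carrier_mat n n" "Q \<in> carrier_mat n n" by (auto simp: P_def Q_def)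
  have P_mult: "(P * M) $$ (i, j) = (if i = 0 then M $$ (0, j) else M $$ (i, j) + M $$ (0, j))"
    if M: "M \<in> carrier_mat n n" and ij: "i < n" "j < n" for M i j
  proof -
    have "(P * M) $$ (i, j) = (\<Sum>k = 0..<n. (if i = k \<or> k = 0 then 1 else 0) * M $$ (k, j))"
      using M ij by (simp add: P_def scalar_prod_def)
    also have "\<dots> = (\<Sum>k = 0..<n. (if k = i then M $$ (k, j) else 0)
                              + (if k = 0 then (if i = 0 then 0 else M $$ (k, j)) else 0))"
      by (rule sum.cong) auto
    also have "\<dots> = (if i = 0 then M $$ (0, j) else M $$ (i, j) + M $$ (0, j))"
      using ij by (simp add: sum.distrib)
    finally show ?thesis .
  qed
  have mult_P: "(M * P) $$ (i, j) = (if j = 0 then (\<Sum>k = 0..<n. M $$ (i, k)) else M $$ (i, j))"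
    if M: "M \<in> carrier_mat n n" and ij: "i < n" "j < n" for M i j
  proof -
    have "(M * P) $$ (i, j) = (\<Sum>k = 0..<n. M $$ (i, k) * (if k = j \<or> j = 0 then 1 else 0))"
      using M ij by (simp add: P_def scalar_prod_def)
    also have "\<dots> = (\<Sum>k = 0..<n. if k = j \<or> j = 0 then M $$ (i, k) else 0)"
      by (rule sum.cong) auto
    also have "\<dots> = (if j = 0 then (\<Sum>k = 0..<n. M $$ (i, k)) else M $$ (i, j))"
      using ij by simp
    finally show ?thesis .
  qed
  have PQ: "P * Q = 1\<^sub>m n"
  proof (rule eq_matI)
    fix i j assume "i < dim_row (1\<^sub>m n :: 'a mat)" "j < dim_col (1\<^sub>m n :: 'a mat)"
    thus "(P * Q) $$ (i, j) = 1\<^sub>m n $$ (i, j)"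
      by (subst P_mult[OF dims(2)]) (auto simp: Q_def)
  qed (use dims in auto)
  have QP: "Q * P = 1\<^sub>m n"
    using mat_mult_left_right_inverse[OF dims PQ] .
  have triangular: "char_poly M = [:- d, 1:] * char_poly R"
    if M: "M \<in> carrier_mat n n" and row: "\<And>i. i < n \<Longrightarrow> (\<Sum>j = 0..<n. M $$ (i, j)) = d"
      and R: "\<And>i j. i < m \<Longrightarrow> j < m \<Longrightarrow> M $$ (Suc i, Suc j) - M $$ (0, Suc j) = R $$ (i, j)"
    for M d
  proof -
    define T where "T = four_block_mat (mat 1 1 (\<lambda>_. d)) (mat 1 m (\<lambda>(i, j). M $$ (0, Suc j))) (0\<^sub>m m 1) R"
    have T: "T \<in> carrier_mat n n" by (auto simp: T_def R_def n)
    have "M * P = P * T"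
    proof (rule eq_matI)
      fix i j assume "i < dim_row (P * T)" "j < dim_col (P * T)"
      hence ij: "i < n" "j < n" using dims T by auto
      show "(M * P) $$ (i, j) = (P * T) $$ (i, j)"
        unfolding mult_P[OF M ij] P_mult[OF T ij] row[OF ij(1)]
        using ij n R[of "i - 1" "j - 1"]
        by (cases i; cases j) (auto simp: T_def R_def algebra_simps)
    qed (use dims T M in auto)
    hence "P * T * Q = M * P * Q" by simp
    also have "\<dots> = M" using M dims PQ by (simp add: assoc_mult_mat[OF M dims])
    finally have "similar_mat M T"
      by (intro similar_matI[of _ _ P Q n]) (use M T dims PQ QP in auto)
    hence "char_poly M = char_poly T" by (rule char_poly_similar)
    also have "\<dots> = char_poly (mat 1 1 (\<lambda>_. d)) * char_poly R"
      unfolding T_def by (rule char_poly_four_block_zeros_col) (auto simp: R_def)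
    also have "char_poly (mat 1 1 (\<lambda>_. d)) = [:- d, 1:]"
      by (subst char_poly_upper_triangular) (auto simp: diag_mat_def)
    finally show ?thesis .
  qed
  have "char_poly A = [:- c, 1:] * char_poly R"
    by (rule triangular) (use A row_sum in \<open>auto simp: R_def\<close>)
  moreover have "char_poly (A + mat n n (\<lambda>_. t)) = [:- (c + of_nat n * t), 1:] * char_poly R"
    by (rule triangular) (use A row_sum n in \<open>auto simp: R_def sum.distrib\<close>)
  ultimately show ?thesis by (simp only: mult_ac)
qed

lemma char_poly_block_diagonal:
  fixes A B :: "'a :: idom mat"
  assumes "A \<in> carrier_mat n n" "B \<in> carrier_mat m m"
  shows "char_poly (four_block_mat A (0\<^sub>m n m) (0\<^sub>m m n) B) = char_poly A * char_poly B"
proof -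
  have "char_poly_matrix (four_block_mat A (0\<^sub>m n m) (0\<^sub>m m n) B)
      = four_block_mat (char_poly_matrix A) (0\<^sub>m n m) (0\<^sub>m m n) (char_poly_matrix B)"
    by (rule eq_matI) (use assms in \<open>auto simp: char_poly_matrix_def\<close>)
  thus ?thesis
    unfolding char_poly_def using assms
    by (simp add: det_four_block_mat_lower_left_zero[of _ n _ m])
qed

lemma monic_splits_eq_prod_roots:
  fixes p :: "'a :: idom poly"
  assumes "monic p" "size (proots p) = degree p"
  shows "p = (\<Prod>x\<in>#proots p. [:- x, 1:])"
  using assms
proof (induction "degree p" arbitrary: p)
  case 0
  thus ?case by (auto simp: monic_degree_0)
next
  case (Suc d)
  then obtain x where "x \<in># proots p" by (metis multiset_nonemptyE nat.simps(3) size_empty)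
  with Suc.prems have "poly p x = 0" by (cases "p = 0") auto
  then obtain q where q: "p = [:- x, 1:] * q" by (metis poly_eq_0_iff_dvd dvdE)
  with Suc.prems have "q \<noteq> 0" by auto
  have roots: "proots p = add_mset x (proots q)"
    unfolding q using \<open>q \<noteq> 0\<close> by (subst proots_mult) auto
  have deg: "degree p = Suc (degree q)"
    unfolding q using \<open>q \<noteq> 0\<close> by (subst degree_mult_eq) auto
  have "lead_coeff q = 1"
    using Suc.prems(1) unfolding q lead_coeff_mult by simp
  with Suc have "q = (\<Prod>x\<in>#proots q. [:- x, 1:])"
    using deg roots by simp
  thus ?case using roots q by simp
qed

lemma char_poly_real_symmetric_splits:
  fixes A :: "real mat"
  assumes A: "A \<in> carrier_mat n n" and sym: "\<And>i j. i < n \<Longrightarrow> j < n \<Longrightarrow> A $$ (i, j) = A $$ (j, i)"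
  shows "char_poly A = (\<Prod>x\<in>#proots (char_poly A). [:- x, 1:])"
  using degree_monic_char_poly[OF A] size_proots_char_poly_real_symmetric[OF assms]
  by (intro monic_splits_eq_prod_roots) auto

text \<open>
  Both sides are determinants of the same characteristic matrix at each real point, and a
  polynomial over an infinite field is determined by its values.
\<close>

lemma char_poly_add_scalar:
  fixes A :: "real mat"
  assumes A: "A \<in> carrier_mat n n"
  shows "char_poly (A + c \<cdot>\<^sub>m 1\<^sub>m n) = char_poly A \<circ>\<^sub>p [:- c, 1:]"
proof (rule poly_ext)
  fix x
  have "char_matrix (A + c \<cdot>\<^sub>m 1\<^sub>m n) x = char_matrix A (x - c)"
    using A by (intro eq_matI) (auto simp: char_matrix_def)
  thus "poly (char_poly (A + c \<cdot>\<^sub>m 1\<^sub>m n)) x = poly (char_poly A \<circ>\<^sub>p [:- c, 1:]) x"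
    using A by (simp add: char_poly_matrix[where n = n] poly_pcompose)
qed

lemma proots_char_poly_add_scalar:
  fixes A :: "real mat"
  assumes A: "A \<in> carrier_mat n n" and sym: "\<And>i j. i < n \<Longrightarrow> j < n \<Longrightarrow> A $$ (i, j) = A $$ (j, i)"
  shows "proots (char_poly (A + c \<cdot>\<^sub>m 1\<^sub>m n)) = image_mset (\<lambda>x. x + c) (proots (char_poly A))"
proof -
  have pcompose_shift: "(\<Prod>x\<in>#S. [:- x, 1:]) \<circ>\<^sub>p [:- c, 1:] = (\<Prod>x\<in>#S. [:- (x + c), 1:])"
    for S :: "real multiset"
  proof (induction S)
    case (add x S)
    have "(\<Prod>y\<in>#add_mset x S. [:- y, 1:]) \<circ>\<^sub>p [:- c, 1:]
        = ([:- x, 1:] \<circ>\<^sub>p [:- c, 1:]) * ((\<Prod>y\<in>#S. [:- y, 1:]) \<circ>\<^sub>p [:- c, 1:])"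
      by (simp only: image_mset_add_mset prod_mset.add_mset pcompose_mult)
    also have "[:- x, 1:] \<circ>\<^sub>p [:- c, 1:] = [:- (x + c), 1:]"
      by (simp add: pcompose_pCons)
    finally show ?case
      by (simp only: add.IH image_mset_add_mset prod_mset.add_mset)
  qed (simp add: pcompose_1)
  have proots_linear_factors: "proots (\<Prod>x\<in>#S. [:- (x + c), 1:]) = image_mset (\<lambda>x. x + c) S"
    for S :: "real multiset"
  proof (induction S)
    case (add x S)
    have "(\<Prod>y\<in>#S. [:- (y + c), 1:]) \<noteq> 0" by (auto simp: prod_mset_zero_iff)
    hence "proots ([:- (x + c), 1:] * (\<Prod>y\<in>#S. [:- (y + c), 1:]))
        = proots [:- (x + c), 1:] + proots (\<Prod>y\<in>#S. [:- (y + c), 1:])"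
      by (intro proots_mult) auto
    also have "proots [:- (x + c), 1:] = {#x + c#}"
      by (subst proots_linear_factor) simp
    finally show ?case
      by (simp only: add.IH image_mset_add_mset prod_mset.add_mset
          add_mset_add_mset_same_iff union_mset_add_mset_left add_0)
  qed simp
  have "char_poly (A + c \<cdot>\<^sub>m 1\<^sub>m n) = (\<Prod>x\<in>#proots (char_poly A). [:- x, 1:]) \<circ>\<^sub>p [:- c, 1:]"
    using char_poly_real_symmetric_splits[OF assms] char_poly_add_scalar[OF A] by simp
  also have "\<dots> = (\<Prod>x\<in>#proots (char_poly A). [:- (x + c), 1:])"
    using pcompose_shift .
  also have "proots \<dots> = image_mset (\<lambda>x. x + c) (proots (char_poly A))"
    by (rule proots_linear_factors)
  finally show ?thesis .
qed

text \<open>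
  The trace is invariant under similarity, and a Schur decomposition has the eigenvalues on its
  diagonal.
\<close>

lemma sum_proots_char_poly_real_symmetric:
  fixes A :: "real mat"
  assumes A: "A \<in> carrier_mat n n" and sym: "\<And>i j. i < n \<Longrightarrow> j < n \<Longrightarrow> A $$ (i, j) = A $$ (j, i)"
  shows "sum_mset (proots (char_poly A)) = (\<Sum>i = 0..<n. A $$ (i, i))"
proof -
  obtain es where es: "mset es = proots (char_poly A)" using ex_mset by blast
  have "char_poly A = (\<Prod>x\<leftarrow>es. [:- x, 1:])"
    using char_poly_real_symmetric_splits[OF assms] unfolding es[symmetric]
    by (simp flip: mset_map add: prod_mset_prod_list)
  moreover obtain B P Q where "schur_decomposition A es = (B, P, Q)" by (metis prod_cases3)
  ultimately have "similar_mat_wit A B P Q" and diag: "diag_mat B = es"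
    using schur_decomposition[OF A] by blast+
  hence wit: "P * Q = 1\<^sub>m n" "Q * P = 1\<^sub>m n" "A = P * B * Q"
    and dims: "B \<in> carrier_mat n n" "P \<in> carrier_mat n n" "Q \<in> carrier_mat n n"
    using A by (auto simp: similar_mat_wit_def Let_def)
  have trace_comm: "(\<Sum>i = 0..<n. (C * D) $$ (i, i)) = (\<Sum>i = 0..<n. (D * C) $$ (i, i))"
    if "C \<in> carrier_mat n n" "D \<in> carrier_mat n n" for C D :: "real mat"
    using that by (simp add: scalar_prod_def mult.commute) (rule sum.swap)
  have "(\<Sum>i = 0..<n. A $$ (i, i)) = (\<Sum>i = 0..<n. (P * (B * Q)) $$ (i, i))"
    using wit(3) dims by simp
  also have "\<dots> = (\<Sum>i = 0..<n. (B * Q * P) $$ (i, i))"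
    using dims by (intro trace_comm) auto
  also have "B * Q * P = B"
    using dims wit(2) by (simp add: assoc_mult_mat[OF dims(1,3,2)])
  also have "(\<Sum>i = 0..<n. B $$ (i, i)) = sum_list es"
    using dims by (auto simp flip: diag simp: diag_mat_def interv_sum_list_conv_sum_set_nat)
  finally show ?thesis using es by (metis sum_mset_sum_list)
qed

text \<open>
  The argument of Gershgorin's circle theorem: the hypotheses make the matrix diagonally dominant,
  so the row of an entry of maximal absolute value in an eigenvector shows that \<open>x\<close> lies in a disc
  around \<open>A $$ (i, i)\<close> of radius at most \<open>A $$ (i, i)\<close>.
\<close>

lemma eigenvalue_nonneg_of_nonpos_off_diagonal:
  fixes A :: "real mat"
  assumes A: "A \<in> carrier_mat n n"
    and row_sum: "\<And>i. i < n \<Longrightarrow> (\<Sum>j = 0..<n. A $$ (i, j)) \<ge> 0"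
    and off: "\<And>i j. i < n \<Longrightarrow> j < n \<Longrightarrow> i \<noteq> j \<Longrightarrow> A $$ (i, j) \<le> 0"
    and ev: "eigenvalue A x"
  shows "x \<ge> 0"
proof -
  from ev A obtain v where v: "v \<in> carrier_vec n" "v \<noteq> 0\<^sub>v n" "A *\<^sub>v v = x \<cdot>\<^sub>v v"
    by (auto simp: eigenvalue_def eigenvector_def)
  then have "n > 0" by (cases n) auto
  have "Max ((\<lambda>i. \<bar>v $ i\<bar>) ` {0..<n}) \<in> (\<lambda>i. \<bar>v $ i\<bar>) ` {0..<n}"
    using \<open>n > 0\<close> by (intro Max_in) auto
  then obtain i where "i < n" "\<bar>v $ i\<bar> = Max ((\<lambda>i. \<bar>v $ i\<bar>) ` {0..<n})" by auto
  then have i: "i < n" and max: "\<And>j. j < n \<Longrightarrow> \<bar>v $ j\<bar> \<le> \<bar>v $ i\<bar>" by auto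
  have pos: "\<bar>v $ i\<bar> > 0"
  proof (rule ccontr)
    assume "\<not> \<bar>v $ i\<bar> > 0"
    hence "\<And>j. j < n \<Longrightarrow> v $ j = 0" using max by fastforce
    hence "v = 0\<^sub>v n" using v(1) by auto
    with v(2) show False by contradiction
  qed
  have split: "(\<Sum>j = 0..<n. g j) = g i + (\<Sum>j \<in> {0..<n} - {i}. g j)" for g :: "nat \<Rightarrow> real"
    using i by (intro sum.remove) auto
  have "(A *\<^sub>v v) $ i = (\<Sum>j = 0..<n. A $$ (i, j) * v $ j)"
    using i A v(1) by (simp add: scalar_prod_def)
  hence "(x - A $$ (i, i)) * v $ i = (\<Sum>j \<in> {0..<n} - {i}. A $$ (i, j) * v $ j)"
    using v i by (simp add: split algebra_simps)
  hence "\<bar>x - A $$ (i, i)\<bar> * \<bar>v $ i\<bar> = \<bar>\<Sum>j \<in> {0..<n} - {i}. A $$ (i, j) * v $ j\<bar>"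
    by (metis abs_mult)
  also have "\<dots> \<le> (\<Sum>j \<in> {0..<n} - {i}. (- A $$ (i, j)) * \<bar>v $ i\<bar>)"
    by (rule order_trans[OF sum_abs], rule sum_mono)
      (use off i max in \<open>auto simp: abs_mult abs_of_nonpos intro!: mult_left_mono_neg\<close>)
  also have "\<dots> = (\<Sum>j \<in> {0..<n} - {i}. - A $$ (i, j)) * \<bar>v $ i\<bar>"
    by (simp add: sum_distrib_right)
  also have "\<dots> \<le> A $$ (i, i) * \<bar>v $ i\<bar>"
    using row_sum[OF i] by (intro mult_right_mono) (auto simp: split sum_negf)
  finally have "\<bar>x - A $$ (i, i)\<bar> \<le> A $$ (i, i)"
    using pos by simp
  thus ?thesis by linarith
qed

section \<open>Degrees and numbers of edges\<close>

lemma out_degree_eq_card: "out_degree (with_proj G) u = card {v. (u, v) \<in> parcs G}"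
proof -
  have "out_arcs (with_proj G) u = Pair u ` {v. (u, v) \<in> parcs G}"
    by (auto simp: out_arcs_def)
  thus ?thesis by (simp add: out_degree_def card_image inj_on_def)
qed

lemma finite_parcs: "pair_graph G \<Longrightarrow> finite (parcs G)"
  by (rule finite_subset[of _ "pverts G \<times> pverts G"]) (auto dest: pair_graph_arcs(2,3) intro: pair_graph_arcs(1))

lemma sum_out_degree:
  assumes "pair_graph G"
  shows "(\<Sum>u\<in>pverts G. out_degree (with_proj G) u) = card (parcs G)"
proof -
  have "finite {v. (u, v) \<in> parcs G}" for u
    by (rule finite_subset[of _ "pverts G"])
      (auto intro: pair_graph_arcs(1)[OF assms] dest: pair_graph_arcs(3)[OF assms])
  hence "(\<Sum>u\<in>pverts G. out_degree (with_proj G) u) = card (SIGMA u:pverts G. {v. (u, v) \<in> parcs G})"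
    using pair_graph_arcs(1)[OF assms] by (simp add: out_degree_eq_card)
  also have "(SIGMA u:pverts G. {v. (u, v) \<in> parcs G}) = parcs G"
    using pair_graph_arcs(2)[OF assms] by auto
  finally show ?thesis .
qed

text \<open>
  Arcs come in opposite pairs and there are no loops, so every endpoint set arises from exactly two
  arcs.
\<close>

lemma card_parcs_eq:
  assumes "pair_graph G"
  shows "card (parcs G) = 2 * num_edges G"
proof -
  let ?f = "\<lambda>(u, v). {u, v}"
  have "card (parcs G) = (\<Sum>y\<in>?f ` parcs G. card {x \<in> parcs G. ?f x = y})"
    using sum.image_gen[OF finite_parcs[OF assms], of "\<lambda>_. 1::nat" ?f] by simp
  also have "\<dots> = (\<Sum>y\<in>?f ` parcs G. 2)"
  proof (rule sum.cong[OF refl])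
    fix y assume "y \<in> ?f ` parcs G"
    then obtain u v where uv: "(u, v) \<in> parcs G" "y = {u, v}" by auto
    moreover have "(v, u) \<in> parcs G" "u \<noteq> v"
      using uv pair_graph_arcs(4,5)[OF assms] by auto
    ultimately have "{x \<in> parcs G. ?f x = y} = {(u, v), (v, u)}"
      by (auto simp: doubleton_eq_iff)
    with \<open>u \<noteq> v\<close> show "card {x \<in> parcs G. ?f x = y} = 2" by simp
  qed
  finally show ?thesis by (simp add: num_edges_def)
qed

lemma card_pverts_double_graph: "card (pverts (double_graph G)) = 2 * card (pverts G)"
  by (simp add: double_graph_def card_cartesian_product)

lemma num_edges_double_graph:
  assumes "pair_graph G"
  shows "num_edges (double_graph G) = 4 * num_edges G"
proof -
  let ?f = "\<lambda>((u, v), a, b). ((u, a), (v, b))"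
  have "parcs (double_graph G) = ?f ` (parcs G \<times> {1::nat, 2} \<times> {1::nat, 2})"
    by (force simp: double_graph_def image_iff)
  moreover have "inj_on ?f (parcs G \<times> {1::nat, 2} \<times> {1::nat, 2})"
    by (auto simp: inj_on_def)
  ultimately have "card (parcs (double_graph G)) = 4 * card (parcs G)"
    by (simp add: card_image card_cartesian_product)
  thus ?thesis
    using card_parcs_eq[OF assms] card_parcs_eq[OF pair_graph_double_graph[OF assms]] by simp
qed

lemma card_pverts_extended_double_cover:
  "pair_graph G \<Longrightarrow> card (pverts (extended_double_cover G)) = 2 * card (pverts G)"
  by (simp add: extended_double_cover_def card_Plus pair_graph_arcs(1))

lemma num_edges_extended_double_cover:
  assumes "pair_graph G"
  shows "num_edges (extended_double_cover G) = card (pverts G) + 2 * num_edges G"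
proof -
  \<comment> \<open>Each pair in \<open>R\<close>, including the loops added for \<open>x\<^sub>i y\<^sub>i\<close>, gives one arc in each direction.\<close>
  define R where "R = Id_on (pverts G) \<union> parcs G"
  let ?f = "\<lambda>(u, v). (Inl u, Inr v) :: ('a + 'a) \<times> ('a + 'a)"
    and ?g = "\<lambda>(u, v). (Inr v, Inl u) :: ('a + 'a) \<times> ('a + 'a)"
  have "Id_on (pverts G) = (\<lambda>u. (u, u)) ` pverts G" by auto
  hence "card (Id_on (pverts G)) = card (pverts G)" "finite (Id_on (pverts G))"
    by (simp_all add: card_image inj_on_def pair_graph_arcs(1)[OF assms])
  moreover have "Id_on (pverts G) \<inter> parcs G = {}"
    using pair_graph_arcs(5)[OF assms] by auto
  ultimately have R: "finite R" "card R = card (pverts G) + card (parcs G)"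
    unfolding R_def by (auto simp: card_Un_disjoint finite_parcs[OF assms])
  have "parcs (extended_double_cover G) = ?f ` R \<union> ?g ` R"
    using pair_graph_arcs(2,3)[OF assms]
    by (auto simp: extended_double_cover_def R_def Id_on_def image_iff)
  moreover have "?f ` R \<inter> ?g ` R = {}" by auto
  moreover have "inj_on ?f R" "inj_on ?g R" by (auto simp: inj_on_def)
  ultimately have "card (parcs (extended_double_cover G)) = 2 * card R"
    by (simp add: card_Un_disjoint card_image R(1))
  thus ?thesis
    using card_parcs_eq[OF assms] card_parcs_eq[OF pair_graph_extended_double_cover[OF assms]] R(2)
    by simp
qed

lemma card_pverts_graph_join:
  "pair_graph G \<Longrightarrow> pair_graph H \<Longrightarrow>
    card (pverts (graph_join G H)) = card (pverts G) + card (pverts H)"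
  by (simp add: graph_join_def card_Plus pair_graph_arcs(1))

lemma out_degree_graph_join:
  assumes "pair_graph G" "pair_graph H"
  shows "u \<in> pverts G \<Longrightarrow>
      out_degree (with_proj (graph_join G H)) (Inl u) = out_degree (with_proj G) u + card (pverts H)"
    and "v \<in> pverts H \<Longrightarrow>
      out_degree (with_proj (graph_join G H)) (Inr v) = out_degree (with_proj H) v + card (pverts G)"
proof -
  have fin: "finite {w. (u, w) \<in> parcs G}" "finite {w. (v, w) \<in> parcs H}" for u v
    by (rule finite_subset[OF _ pair_graph_arcs(1)[OF assms(1)]],
        use pair_graph_arcs(3)[OF assms(1)] in blast)
      (rule finite_subset[OF _ pair_graph_arcs(1)[OF assms(2)]],
        use pair_graph_arcs(3)[OF assms(2)] in blast)
  note fin' = fin pair_graph_arcs(1)[OF assms(1)] pair_graph_arcs(1)[OF assms(2)]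
  show "out_degree (with_proj (graph_join G H)) (Inl u) = out_degree (with_proj G) u + card (pverts H)"
    if "u \<in> pverts G"
  proof -
    have "{w. (Inl u, w) \<in> parcs (graph_join G H)} = {w. (u, w) \<in> parcs G} <+> pverts H"
      using that by (auto simp: graph_join_def)
    thus ?thesis by (simp add: out_degree_eq_card card_Plus fin')
  qed
  show "out_degree (with_proj (graph_join G H)) (Inr v) = out_degree (with_proj H) v + card (pverts G)"
    if "v \<in> pverts H"
  proof -
    have "{w. (Inr v, w) \<in> parcs (graph_join G H)} = pverts G <+> {w. (v, w) \<in> parcs H}"
      using that by (auto simp: graph_join_def)
    thus ?thesis by (simp add: out_degree_eq_card card_Plus fin')
  qed
qed

lemma num_edges_graph_join:
  assumes "pair_graph G" "pair_graph H"
  shows "num_edges (graph_join G H) = num_edges G + num_edges H + card (pverts G) * card (pverts H)"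
proof -
  note fin = pair_graph_arcs(1)[OF assms(1)] pair_graph_arcs(1)[OF assms(2)]
  let ?J = "graph_join G H"
  have "card (parcs ?J) = (\<Sum>w\<in>pverts G <+> pverts H. out_degree (with_proj ?J) w)"
    unfolding sum_out_degree[OF pair_graph_graph_join[OF assms], symmetric]
    by (rule sum.cong) (simp_all add: graph_join_def)
  also have "\<dots> = (\<Sum>u\<in>pverts G. out_degree (with_proj G) u + card (pverts H))
                + (\<Sum>v\<in>pverts H. out_degree (with_proj H) v + card (pverts G))"
    using fin by (simp add: sum.Plus out_degree_graph_join[OF assms])
  also have "\<dots> = card (parcs G) + card (parcs H) + 2 * (card (pverts G) * card (pverts H))"
    using assms by (simp add: sum.distrib sum_out_degree)
  finally show ?thesis
    using assms by (simp add: card_parcs_eq pair_graph_graph_join)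
qed

section \<open>The Laplacian spectrum\<close>

lemma sum_nth_eq_sum_set:
  "distinct xs \<Longrightarrow> (\<Sum>i = 0..<length xs. f (xs ! i)) = (\<Sum>x\<in>set xs. f x)"
  by (simp add: sum.distinct_set_conv_list sum_list_sum_nth)

lemma laplacian_mat_index:
  assumes "distinct vs" "i < length vs" "j < length vs"
  shows "laplacian_mat vs G $$ (i, j) = laplacian_entry G (vs ! i) (vs ! j)"
  using assms by (simp add: laplacian_mat_eq)

lemma laplacian_mat_sym:
  assumes "pair_graph G" "distinct vs" "i < length vs" "j < length vs"
  shows "laplacian_mat vs G $$ (i, j) = laplacian_mat vs G $$ (j, i)"
  using assms by (auto simp: laplacian_mat_index laplacian_entry_def pair_graph_arcs(4))

lemma laplacian_mat_row_sum:
  assumes G: "pair_graph G" and vs: "distinct vs" "set vs = pverts G" and i: "i < length vs"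
  shows "(\<Sum>j = 0..<length vs. laplacian_mat vs G $$ (i, j)) = 0"
proof -
  let ?u = "vs ! i"
  have u: "?u \<in> pverts G" using i vs(2) nth_mem by blast
  have "(\<Sum>j = 0..<length vs. laplacian_mat vs G $$ (i, j)) =
        (\<Sum>j = 0..<length vs. laplacian_entry G ?u (vs ! j))"
    by (rule sum.cong) (use i vs in \<open>auto simp: laplacian_mat_index\<close>)
  also have "\<dots> = (\<Sum>v\<in>pverts G. laplacian_entry G ?u v)"
    unfolding vs(2)[symmetric] by (rule sum_nth_eq_sum_set[OF vs(1)])
  also have "\<dots> = real (out_degree (with_proj G) ?u) - real (card (pverts G \<inter> {v. (?u, v) \<in> parcs G}))"
  proof -
    have "(\<Sum>v\<in>pverts G. if (?u, v) \<in> parcs G then 1 else 0) =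
        real (card (pverts G \<inter> {v. (?u, v) \<in> parcs G}))"
      using pair_graph_arcs(1)[OF G] by (simp add: sum.If_cases)
    thus ?thesis
      using u pair_graph_arcs(1)[OF G] by (simp add: laplacian_entry_def sum_subtractf)
  qed
  also have "pverts G \<inter> {v. (?u, v) \<in> parcs G} = {v. (?u, v) \<in> parcs G}"
    using pair_graph_arcs(3)[OF G] by auto
  finally show ?thesis by (simp add: out_degree_eq_card)
qed

lemma obtain_vertex_enumeration:
  assumes "pair_graph G"
  obtains vs where "distinct vs" "set vs = pverts G" "length vs = card (pverts G)"
  using finite_distinct_list[OF pair_graph_arcs(1)[OF assms]] distinct_card by metis

lemma laplacian_spectrum_nonneg:
  assumes G: "pair_graph G" and x: "x \<in># laplacian_spectrum G"
  shows "x \<ge> 0"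
proof -
  obtain vs where vs: "distinct vs" "set vs = pverts G"
    using obtain_vertex_enumeration[OF G] by blast
  let ?L = "laplacian_mat vs G"
  have "poly (char_poly ?L) x = 0"
    using x by (cases "char_poly ?L = 0") (auto simp: laplacian_spectrum_eq[OF vs])
  hence "eigenvalue ?L x"
    by (subst eigenvalue_root_char_poly[OF laplacian_mat_carrier])
  moreover have "?L $$ (i, j) \<le> 0" if "i < length vs" "j < length vs" "i \<noteq> j" for i j
    using that vs(1) by (simp add: laplacian_mat_index laplacian_entry_def nth_eq_iff_index_eq)
  ultimately show ?thesis
    using eigenvalue_nonneg_of_nonpos_off_diagonal[OF laplacian_mat_carrier]
      laplacian_mat_row_sum[OF G vs] by (metis order_refl)
qed

lemma sum_laplacian_spectrum:
  assumes G: "pair_graph G"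
  shows "sum_mset (laplacian_spectrum G) = 2 * real (num_edges G)"
proof -
  obtain vs where vs: "distinct vs" "set vs = pverts G"
    using obtain_vertex_enumeration[OF G] by blast
  have "sum_mset (laplacian_spectrum G) = (\<Sum>i = 0..<length vs. laplacian_mat vs G $$ (i, i))"
    unfolding laplacian_spectrum_eq[OF vs]
    by (rule sum_proots_char_poly_real_symmetric) (auto intro: laplacian_mat_sym[OF G vs(1)])
  also have "\<dots> = (\<Sum>i = 0..<length vs. real (out_degree (with_proj G) (vs ! i)))"
    by (rule sum.cong) (auto simp: laplacian_mat_index[OF vs(1)] laplacian_entry_def pair_graph_arcs(5)[OF G])
  also have "\<dots> = (\<Sum>v\<in>pverts G. real (out_degree (with_proj G) v))"
    unfolding vs(2)[symmetric] by (rule sum_nth_eq_sum_set[OF vs(1)])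
  also have "\<dots> = 2 * real (num_edges G)"
    using sum_out_degree[OF G] card_parcs_eq[OF G] by (simp flip: of_nat_sum)
  finally show ?thesis .
qed

lemma laplacian_spectrum_edgeless_graph:
  "laplacian_spectrum (edgeless_graph p) = replicate_mset p 0"
proof -
  have "laplacian_spectrum (edgeless_graph p) = proots (char_poly (laplacian_mat [0..<p] (edgeless_graph p)))"
    by (rule laplacian_spectrum_eq) (auto simp: edgeless_graph_def)
  also have "laplacian_mat [0..<p] (edgeless_graph p) = 0\<^sub>m p p"
    by (rule eq_matI)
      (auto simp: laplacian_mat_index laplacian_entry_def out_degree_eq_card edgeless_graph_def
        carrier_matD[OF laplacian_mat_carrier])
  also have "char_poly (0\<^sub>m p p :: real mat) = [:0, 1:] ^ p"
  proof -
    have "diag_mat (0\<^sub>m p p :: real mat) = replicate p 0"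
      by (rule nth_equalityI) (auto simp: diag_mat_def)
    moreover have "upper_triangular (0\<^sub>m p p :: real mat)" by auto
    ultimately show ?thesis
      using char_poly_upper_triangular[of "0\<^sub>m p p :: real mat" p] by simp
  qed
  also have "proots ([:0, 1:] ^ p) = replicate_mset p (0::real)"
    unfolding proots_power by (induction p) auto
  finally show ?thesis .
qed

lemma laplacian_entry_graph_join:
  assumes "pair_graph G" "pair_graph H"
  shows "u \<in> pverts G \<Longrightarrow> laplacian_entry (graph_join G H) (Inl u) (Inl u') =
      laplacian_entry G u u' + (if u = u' then real (card (pverts H)) else 0)"
    and "v \<in> pverts H \<Longrightarrow> laplacian_entry (graph_join G H) (Inr v) (Inr v') =
      laplacian_entry H v v' + (if v = v' then real (card (pverts G)) else 0)"
    and "u \<in> pverts G \<Longrightarrow> v \<in> pverts H \<Longrightarrow> laplacian_entry (graph_join G H) (Inl u) (Inr v) = - 1"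
    and "u \<in> pverts G \<Longrightarrow> v \<in> pverts H \<Longrightarrow> laplacian_entry (graph_join G H) (Inr v) (Inl u) = - 1"
proof -
  have arcs: "(Inl u, Inl u') \<in> parcs (graph_join G H) \<longleftrightarrow> (u, u') \<in> parcs G"
    "(Inr v, Inr v') \<in> parcs (graph_join G H) \<longleftrightarrow> (v, v') \<in> parcs H"
    "(Inl u, Inr v) \<in> parcs (graph_join G H) \<longleftrightarrow> u \<in> pverts G \<and> v \<in> pverts H"
    "(Inr v, Inl u) \<in> parcs (graph_join G H) \<longleftrightarrow> u \<in> pverts G \<and> v \<in> pverts H" for u u' v v'
    by (auto simp: graph_join_def)
  show "u \<in> pverts G \<Longrightarrow> laplacian_entry (graph_join G H) (Inl u) (Inl u') =
      laplacian_entry G u u' + (if u = u' then real (card (pverts H)) else 0)"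
    and "v \<in> pverts H \<Longrightarrow> laplacian_entry (graph_join G H) (Inr v) (Inr v') =
      laplacian_entry H v v' + (if v = v' then real (card (pverts G)) else 0)"
    and "u \<in> pverts G \<Longrightarrow> v \<in> pverts H \<Longrightarrow> laplacian_entry (graph_join G H) (Inl u) (Inr v) = - 1"
    and "u \<in> pverts G \<Longrightarrow> v \<in> pverts H \<Longrightarrow> laplacian_entry (graph_join G H) (Inr v) (Inl u) = - 1"
    by (auto simp: laplacian_entry_def arcs out_degree_graph_join[OF assms])
qed

text \<open>
  With \<open>LG\<close>, \<open>LH\<close> and \<open>LJ\<close> the Laplacian matrices of \<open>G\<close>, \<open>H\<close> and their join, and with \<open>J\<close> the
  all-ones matrix of suitable size, \<open>LJ + J\<close> is block diagonal with blocks \<open>LG + m I + J\<close> and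
  \<open>LH + n I + J\<close>.  Removing \<open>J\<close> on both sides exchanges one root each: \<open>n + m\<close> for \<open>0\<close> in the join,
  \<open>n + m\<close> for \<open>m\<close> in the first block, and \<open>n + m\<close> for \<open>n\<close> in the second block.  The exchanged
  roots \<open>m\<close> and \<open>n\<close> stay on the left-hand side, which avoids singling out an eigenvalue \<open>0\<close> of \<open>G\<close>
  and of \<open>H\<close>.
\<close>

lemma laplacian_spectrum_graph_join:
  assumes G: "pair_graph G" and H: "pair_graph H"
  defines "n \<equiv> card (pverts G)" and "m \<equiv> card (pverts H)"
  shows "laplacian_spectrum (graph_join G H) + {#real m, real n#} =
    {#0, real (n + m)#} + image_mset (\<lambda>x. x + real m) (laplacian_spectrum G)
      + image_mset (\<lambda>x. x + real n) (laplacian_spectrum H)"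
proof -
  obtain us where us: "distinct us" "set us = pverts G" "length us = n"
    using obtain_vertex_enumeration[OF G] n_def by blast
  obtain vs where vs: "distinct vs" "set vs = pverts H" "length vs = m"
    using obtain_vertex_enumeration[OF H] m_def by blast
  define ws where "ws = map Inl us @ map Inr vs"
  have J: "pair_graph (graph_join G H)" using G H by (rule pair_graph_graph_join)
  have ws: "distinct ws" "set ws = pverts (graph_join G H)" "length ws = n + m"
    using us vs by (auto simp: ws_def distinct_map graph_join_def)
  define LG where "LG = laplacian_mat us G"
  define LH where "LH = laplacian_mat vs H"
  define LJ where "LJ = laplacian_mat ws (graph_join G H)"
  define A where "A = LG + real m \<cdot>\<^sub>m 1\<^sub>m n"
  define B where "B = LH + real n \<cdot>\<^sub>m 1\<^sub>m m"
  have LG: "LG \<in> carrier_mat n n" and LH: "LH \<in> carrier_mat m m" and LJ: "LJ \<in> carrier_mat (n + m) (n + m)"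
    using laplacian_mat_carrier us(3) vs(3) ws(3) unfolding LG_def LH_def LJ_def by metis+
  have A: "A \<in> carrier_mat n n" and B: "B \<in> carrier_mat m m"
    using LG LH by (auto simp: A_def B_def)
  have row_shift: "(\<Sum>j = 0..<k. (M + c \<cdot>\<^sub>m 1\<^sub>m k) $$ (i, j)) = (\<Sum>j = 0..<k. M $$ (i, j)) + c"
    if "M \<in> carrier_mat k k" "i < k" for M :: "real mat" and k i c
  proof -
    have "(\<Sum>j = 0..<k. (M + c \<cdot>\<^sub>m 1\<^sub>m k) $$ (i, j)) =
        (\<Sum>j = 0..<k. M $$ (i, j) + (if j = i then c else 0))"
      by (rule sum.cong) (use that in auto)
    thus ?thesis using that by (simp add: sum.distrib)
  qed
  have rowA: "(\<Sum>j = 0..<n. A $$ (i, j)) = real m" if "i < n" for i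
    using laplacian_mat_row_sum[OF G us(1,2), of i] that us(3) row_shift[OF LG that, of "real m"]
    by (simp add: A_def LG_def)
  have rowB: "(\<Sum>j = 0..<m. B $$ (i, j)) = real n" if "i < m" for i
    using laplacian_mat_row_sum[OF H vs(1,2), of i] that vs(3) row_shift[OF LH that, of "real n"]
    by (simp add: B_def LH_def)
  have rowJ: "(\<Sum>j = 0..<n + m. LJ $$ (i, j)) = 0" if "i < n + m" for i
    using laplacian_mat_row_sum[OF J ws(1,2), of i] that ws(3) by (simp add: LJ_def)
  have block: "LJ + mat (n + m) (n + m) (\<lambda>_. 1) =
    four_block_mat (A + mat n n (\<lambda>_. 1)) (0\<^sub>m n m) (0\<^sub>m m n) (B + mat m m (\<lambda>_. 1))" (is "?l = ?r")
  proof (rule eq_matI)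
    fix i j assume "i < dim_row ?r" "j < dim_col ?r"
    hence ij: "i < n + m" "j < n + m" using A B by auto
    have in_G: "us ! k \<in> pverts G" if "k < n" for k using that us nth_mem by blast
    have in_H: "vs ! k \<in> pverts H" if "k < m" for k using that vs nth_mem by blast
    have nth_ws: "ws ! k = (if k < n then Inl (us ! k) else Inr (vs ! (k - n)))" if "k < n + m" for k
      using that us(3) vs(3) by (simp add: ws_def nth_append)
    have A_entry: "A $$ (k, l) = laplacian_entry G (us ! k) (us ! l) + (if us ! k = us ! l then real m else 0)"
      if "k < n" "l < n" for k l
      using that LG us(1,3) laplacian_mat_index[OF us(1), of k l G]
      by (simp add: A_def LG_def nth_eq_iff_index_eq)
    have B_entry: "B $$ (k, l) = laplacian_entry H (vs ! k) (vs ! l) + (if vs ! k = vs ! l then real n else 0)"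
      if "k < m" "l < m" for k l
      using that LH vs(1,3) laplacian_mat_index[OF vs(1), of k l H]
      by (simp add: B_def LH_def nth_eq_iff_index_eq)
    have "?l $$ (i, j) = LJ $$ (i, j) + 1"
      using ij LJ by simp
    also have "LJ $$ (i, j) = laplacian_entry (graph_join G H) (ws ! i) (ws ! j)"
      unfolding LJ_def using ij ws by (intro laplacian_mat_index) auto
    also have "\<dots> = (if i < n then if j < n then A $$ (i, j) else - 1
        else if j < n then - 1 else B $$ (i - n, j - n))"
      unfolding nth_ws[OF ij(1)] nth_ws[OF ij(2)]
      using ij in_G in_H laplacian_entry_graph_join[OF G H, folded n_def m_def]
      by (simp add: A_entry B_entry)
    finally show "?l $$ (i, j) = ?r $$ (i, j)"
      using ij A B by auto
  qed (use A B LJ in auto)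
  define s where "s = [:- real (n + m), 1:]"
  have eqJ: "char_poly (LJ + mat (n + m) (n + m) (\<lambda>_. 1)) * [:0, 1:] = char_poly LJ * s"
    using char_poly_add_all_const[OF LJ rowJ, of 1] by (simp add: s_def)
  have eqA: "char_poly (A + mat n n (\<lambda>_. 1)) * [:- real m, 1:] = char_poly A * s"
    using char_poly_add_all_const[OF A rowA, of 1] by (simp add: s_def add_ac)
  have eqB: "char_poly (B + mat m m (\<lambda>_. 1)) * [:- real n, 1:] = char_poly B * s"
    using char_poly_add_all_const[OF B rowB, of 1] by (simp add: s_def add_ac)
  have prod: "char_poly (LJ + mat (n + m) (n + m) (\<lambda>_. 1)) =
      char_poly (A + mat n n (\<lambda>_. 1)) * char_poly (B + mat m m (\<lambda>_. 1))"
    unfolding block using A B by (intro char_poly_block_diagonal) auto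
  have "s * (char_poly LJ * ([:- real m, 1:] * [:- real n, 1:]))
      = s * (([:0, 1:] * s) * (char_poly A * char_poly B))"
  proof -
    have "s * (char_poly LJ * ([:- real m, 1:] * [:- real n, 1:]))
        = [:0, 1:] * (char_poly (A + mat n n (\<lambda>_. 1)) * [:- real m, 1:])
            * (char_poly (B + mat m m (\<lambda>_. 1)) * [:- real n, 1:])"
    proof -
      have "s * (char_poly LJ * ([:- real m, 1:] * [:- real n, 1:]))
          = (char_poly LJ * s) * ([:- real m, 1:] * [:- real n, 1:])"
        by (simp only: mult_ac)
      thus ?thesis unfolding eqJ[symmetric] prod by (simp only: mult_ac)
    qed
    also have "\<dots> = s * (([:0, 1:] * s) * (char_poly A * char_poly B))"
      unfolding eqA eqB by (simp only: mult_ac)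
    finally show ?thesis .
  qed
  moreover have "s \<noteq> 0" by (simp add: s_def)
  ultimately have eq: "char_poly LJ * ([:- real m, 1:] * [:- real n, 1:])
      = ([:0, 1:] * s) * (char_poly A * char_poly B)"
    using mult_left_cancel by blast
  have nz: "char_poly M \<noteq> 0" if "M \<in> carrier_mat k k" for M :: "real mat" and k
    using degree_monic_char_poly[OF that] by auto
  have "proots (char_poly LJ) + ({#real m#} + {#real n#})
      = proots (char_poly LJ * ([:- real m, 1:] * [:- real n, 1:]))"
    using nz[OF LJ] by (simp add: proots_mult del: mult_pCons_left mult_pCons_right)
  also have "\<dots> = ({#0#} + {#real (n + m)#}) + (proots (char_poly A) + proots (char_poly B))"
    unfolding eq s_def using nz[OF A] nz[OF B]
    by (simp add: proots_mult del: mult_pCons_left mult_pCons_right)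
  finally have "proots (char_poly LJ) + {#real m, real n#}
      = {#0, real (n + m)#} + proots (char_poly A) + proots (char_poly B)"
    by (simp add: add_mset_commute)
  moreover have "proots (char_poly A) = image_mset (\<lambda>x. x + real m) (laplacian_spectrum G)"
    unfolding A_def laplacian_spectrum_eq[OF us(1,2)] LG_def[symmetric]
    by (rule proots_char_poly_add_scalar[OF LG]) (use us laplacian_mat_sym[OF G] in \<open>auto simp: LG_def\<close>)
  moreover have "proots (char_poly B) = image_mset (\<lambda>x. x + real n) (laplacian_spectrum H)"
    unfolding B_def laplacian_spectrum_eq[OF vs(1,2)] LH_def[symmetric]
    by (rule proots_char_poly_add_scalar[OF LH]) (use vs laplacian_mat_sym[OF H] in \<open>auto simp: LH_def\<close>)
  ultimately show ?thesis
    unfolding laplacian_spectrum_eq[OF ws(1,2)] LJ_def by simp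
qed

section \<open>The energy of a join with an edgeless graph\<close>

text \<open>
  Here \<open>a\<close> is the average degree of the join.  The \<open>n\<close> eigenvalues of \<open>G\<close>, shifted by \<open>p\<close>, are all at
  least \<open>a\<close> and together contribute \<open>2 m + n (p - a)\<close>.  The terms \<open>n - 1\<close> and \<open>p - 1\<close> come from moving
  the two extra eigenvalues on the left of \<open>laplacian_spectrum_graph_join\<close> to the other side.
\<close>

lemma laplacian_energy_join_edgeless:
  fixes p :: nat
  assumes G: "pair_graph G"
  defines "n \<equiv> real (card (pverts G))" and "m \<equiv> real (num_edges G)"
  defines "a \<equiv> 2 * (m + n * real p) / (n + real p)"
  assumes a: "a \<le> real p"
  shows "laplacian_energy (graph_join G (edgeless_graph p)) =
    a + \<bar>n + real p - a\<bar> + 2 * m + (n - 1) * (real p - a) + (real p - 1) * \<bar>n - a\<bar>"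
proof -
  let ?K = "edgeless_graph p"
  let ?J = "graph_join G ?K"
  note K = pair_graph_edgeless_graph
  have cardK: "card (pverts ?K) = p" "num_edges ?K = 0"
    by (simp_all add: edgeless_graph_def num_edges_def)
  have mean: "2 * real (num_edges ?J) / real (card (pverts ?J)) = a"
    by (simp add: num_edges_graph_join[OF G K] card_pverts_graph_join[OF G K] cardK a_def n_def m_def)
  define f where "f = (\<lambda>x. \<bar>x - a\<bar>)"
  have "a \<ge> 0" by (simp add: a_def n_def m_def)
  have "laplacian_energy ?J = (\<Sum>x\<in>#laplacian_spectrum ?J. f x)"
    by (simp add: laplacian_energy_def mean f_def)
  moreover have "(\<Sum>x\<in>#laplacian_spectrum ?J + {#real p, n#}. f x) =
      (\<Sum>x\<in>#{#0, n + real p#} + image_mset (\<lambda>x. x + real p) (laplacian_spectrum G)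
        + image_mset (\<lambda>x. x + n) (laplacian_spectrum ?K). f x)"
    using laplacian_spectrum_graph_join[OF G K, of p] by (simp add: cardK n_def)
  moreover have "(\<Sum>x\<in>#image_mset (\<lambda>x. x + real p) (laplacian_spectrum G). f x) = 2 * m + n * (real p - a)"
  proof -
    have "(\<Sum>x\<in>#image_mset (\<lambda>x. x + real p) (laplacian_spectrum G). f x) =
        (\<Sum>x\<in>#laplacian_spectrum G. x + (real p - a))"
      unfolding multiset.map_comp
    proof (intro arg_cong[of _ _ sum_mset] image_mset_cong)
      fix x assume "x \<in># laplacian_spectrum G"
      hence "x \<ge> 0" by (rule laplacian_spectrum_nonneg[OF G])
      thus "(f \<circ> (\<lambda>x. x + real p)) x = x + (real p - a)"
        using a by (simp add: f_def)
    qed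
    also have "\<dots> = 2 * m + n * (real p - a)"
      by (simp add: sum_mset.distrib sum_laplacian_spectrum[OF G] size_laplacian_spectrum[OF G] m_def n_def)
    finally show ?thesis .
  qed
  ultimately show ?thesis
    using a \<open>a \<ge> 0\<close>
    by (simp add: laplacian_spectrum_edgeless_graph f_def algebra_simps)
qed

theorem theorem4p8:
  fixes G1 :: "'a pair_pre_digraph" and G2 :: "'b pair_pre_digraph"
    and n m1 m2 p k :: nat
  assumes "pair_graph G1" and "pair_graph G2"
    and "card (pverts G1) = n" and "card (pverts G2) = n"
    and "num_edges G1 = m1" and "num_edges G2 = m2"
    and "n mod 4 = 0"
    and "real m2 = real m1 + real n / 4"
    and "k \<ge> 4" and "p \<ge> 4 * n + k"
    and "real m2 \<le> real n * (real k - 2) / 4 + (real k)\<^sup>2 / 16"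
  shows "laplacian_energy (graph_join (double_graph (extended_double_cover G1)) (edgeless_graph p))
       = laplacian_energy (graph_join (extended_double_cover (double_graph G2)) (edgeless_graph p))"
proof -
  define H1 where "H1 = double_graph (extended_double_cover G1)"
  define H2 where "H2 = extended_double_cover (double_graph G2)"
  note cover = pair_graph_extended_double_cover and double = pair_graph_double_graph
  have H1: "pair_graph H1" unfolding H1_def by (intro double cover assms)
  have H2: "pair_graph H2" unfolding H2_def by (intro double cover assms)
  have verts: "card (pverts H1) = 4 * n" "card (pverts H2) = 4 * n"
    using assms by (simp_all add: H1_def H2_def card_pverts_double_graph
        card_pverts_extended_double_cover double)
  have "num_edges H1 = 4 * n + 8 * m1" "num_edges H2 = 2 * n + 8 * m2"
    using assms by (simp_all add: H1_def H2_def num_edges_double_graph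
        num_edges_extended_double_cover card_pverts_double_graph double cover)
  hence edges: "real (num_edges H1) = 2 * real n + 8 * real m2" "real (num_edges H2) = 2 * real n + 8 * real m2"
    using \<open>real m2 = real m1 + real n / 4\<close> by simp_all
  let ?N = "4 * real n" and ?M = "2 * real n + 8 * real m2"
  \<comment> \<open>The average degree is at most \<open>p\<close> iff \<open>2 M \<le> p (p - N)\<close>; the bound on \<open>m\<^sub>2\<close> says slightly more
    than \<open>2 M \<le> (N + k) k\<close>.\<close>
  have "2 * (?M + ?N * real p) / (?N + real p) \<le> real p"
  proof -
    have p: "real p \<ge> ?N + real k" using \<open>p \<ge> 4 * n + k\<close> by linarith
    have "2 * ?M \<le> ?N * real k + (real k)\<^sup>2"
    proof -
      have distr: "real n * (real k - 2) = real n * real k - 2 * real n"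
        by (simp add: algebra_simps)
      have "2 * ?M \<le> 4 * (real n * real k) + (real k)\<^sup>2"
      proof -
        have "16 * real m2 \<le> 4 * (real n * real k) - 8 * real n + (real k)\<^sup>2"
          using assms(11) unfolding distr by (simp add: field_simps)
        also have "\<dots> \<le> 4 * (real n * real k) - 4 * real n + (real k)\<^sup>2"
          by simp
        finally show ?thesis by (simp add: algebra_simps)
      qed
      thus ?thesis by simp
    qed
    also have "\<dots> = (?N + real k) * real k"
      by (simp add: power2_eq_square algebra_simps)
    also have "\<dots> \<le> real p * (real p - ?N)"
      using p by (intro mult_mono) auto
    finally have "2 * (?M + ?N * real p) \<le> real p * (?N + real p)"
      by (simp add: algebra_simps)
    moreover have "?N + real p > 0" using p \<open>k \<ge> 4\<close> by linarith
    ultimately show ?thesis by (simp add: pos_divide_le_eq)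
  qed
  hence "laplacian_energy (graph_join H1 (edgeless_graph p)) =
         laplacian_energy (graph_join H2 (edgeless_graph p))"
    using laplacian_energy_join_edgeless[OF H1, of p] laplacian_energy_join_edgeless[OF H2, of p]
    by (simp add: verts edges)
  thus ?thesis by (simp only: H1_def H2_def)
qed

end
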